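(* Let $H=H(\tau)$, $\tau$ real, be an analytic one-parameter family of self-adjoint operators, bounded below, on a Hilbert space $(\mathcal{H},\langle\cdot,\cdot\rangle)$ with common domain $\mathcal{D}_H$, having purely discrete spectrum consisting of eigenvalues $\lambda_j=\lambda_j(\tau)$, $j=1,2,\dots$, analytic in $\tau$, with corresponding eigenvectors $u_j=u_j(\tau)$, analytic in $\tau$, forming a complete orthonormal basis of $\mathcal{H}$. Suppose that the domains of $\dot{H}$ and $\ddot{H}$ contain $\mathcal{D}_H$ and that $\dot H,\ddot H$ map $\mathcal{D}_H$ into $\mathcal{D}_H$. Let $J$ be a subset of the spectrum of $H(\tau)$ with complement $J^c$ in the spectrum, such that $d=d(\tau):=\inf J^c-\sup J>0$, and suppose that $\dot{H}u_j$ and $\dot{H}^2u_j$ are in the domain of $H$. Then $$0\leq \sum_{\lambda_j\in J}\langle\ddot{H}u_j,u_j\rangle-\sum_{\lambda_j\in J}\ddot{\lambda}_j\leq d^{-2}\sum_{\lambda_j\in J}\big\langle[\dot{H},[H,\dot{H}]]u_j,u_j\big\rangle .$$ In particular, when $\dot{H}$ commutes with $H$ we have $$\sum_{\lambda_j\in J}\langle\ddot{H}u_j,u_j\rangle-\sum_{\lambda_j\in J}\ddot{\lambda}_j=0,$$ and consequently $\ddot{\lambda}_j=\langle\ddot{H}u_j,u_j\rangle$ for all $j$.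
   Context: A dot denotes $d/d\tau$; $[X,Y]=XY-YX$. "Analytic family with common domain" means that each $H(\tau)$ is self-adjoint on the same domain $\mathcal{D}_H$ and $\tau\mapsto H(\tau)\psi$ is real analytic for every $\psi\in\mathcal{D}_H$; $\dot H\psi,\ddot H\psi$ are the corresponding derivatives. Eigenvalues are repeated according to (finite) multiplicity, and the sum over $\lambda_j\in J$ is over all indices $j$ with $\lambda_j\in J$. The condition $d>0$ means that $J$ is a bottom part of the spectrum separated by a gap from the rest. The statement is pointwise in $\tau$. *)

theory Defs
  imports "HOL-Analysis.Analysis" "HOL-Library.Complex_Order"
begin

section \<open>Complex Hilbert spaces\<close>

text \<open>The norm and the topology are those of the underlying real Hilbert space, whose inner
  product is the real part of the complex one. The complex inner product is linear in its first
  argument. The order on \<^typ>\<open>complex\<close> is that of \<^theory>\<open>HOL-Library.Complex_Order\<close>: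
  \<open>z \<le> w\<close> means that \<open>w - z\<close> is a nonnegative real number.\<close>

class complex_hilbert = real_inner + complete_space +
  fixes scaleC :: "complex \<Rightarrow> 'a \<Rightarrow> 'a"  (infixr "*\<^sub>C" 75)
    and cinner :: "'a \<Rightarrow> 'a \<Rightarrow> complex"
  assumes scaleC_add_right: "c *\<^sub>C (x + y) = c *\<^sub>C x + c *\<^sub>C y"
    and scaleC_add_left: "(b + c) *\<^sub>C x = b *\<^sub>C x + c *\<^sub>C x"
    and scaleC_scaleC: "b *\<^sub>C c *\<^sub>C x = (b * c) *\<^sub>C x"
    and scaleR_eq_scaleC: "r *\<^sub>R x = complex_of_real r *\<^sub>C x"
    and cinner_add_left: "cinner (x + y) z = cinner x z + cinner y z"
    and cinner_scaleC_left: "cinner (c *\<^sub>C x) y = c * cinner x y"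
    and cinner_commute: "cinner x y = cnj (cinner y x)"
    and inner_eq_Re_cinner: "inner x y = Re (cinner x y)"

global_interpretation complex_space: vector_space "scaleC :: complex \<Rightarrow> 'a \<Rightarrow> 'a::complex_hilbert"
  defines csubspace = complex_space.subspace
    and cspan = complex_space.span
proof
  fix x :: 'a
  show "1 *\<^sub>C x = x"
    using scaleR_eq_scaleC[of 1 x] by simp
qed (simp_all add: scaleC_add_right scaleC_add_left scaleC_scaleC)

definition orthonormal_basis :: "('i \<Rightarrow> 'a::complex_hilbert) \<Rightarrow> bool" where
  "orthonormal_basis u \<longleftrightarrow>
    (\<forall>j k. cinner (u j) (u k) = (if j = k then 1 else 0)) \<and> closure (cspan (range u)) = UNIV"


section \<open>Unbounded operators\<close>

text \<open>An operator is a partial function: \<open>dom T\<close> is its domain, \<open>the (T x)\<close> its value at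
  \<open>x \<in> dom T\<close>, and \<open>A \<circ>\<^sub>m B\<close> is the product \<open>AB\<close> on its natural domain
  \<open>{x \<in> dom B. B x \<in> dom A}\<close>.\<close>

type_synonym 'a operator = "'a \<rightharpoonup> 'a"

definition linear_operator :: "'a::complex_hilbert operator \<Rightarrow> bool" where
  "linear_operator T \<longleftrightarrow> csubspace (dom T) \<and>
    (\<forall>x\<in>dom T. \<forall>y\<in>dom T. the (T (x + y)) = the (T x) + the (T y)) \<and>
    (\<forall>c. \<forall>x\<in>dom T. the (T (c *\<^sub>C x)) = c *\<^sub>C the (T x))"

text \<open>The choice of \<open>z\<close> is unique when \<open>dom T\<close> is dense.\<close>

definition adjoint_operator :: "'a::complex_hilbert operator \<Rightarrow> 'a operator" where
  "adjoint_operator T = (\<lambda>y.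
     if \<exists>z. \<forall>x\<in>dom T. cinner (the (T x)) y = cinner x z
     then Some (SOME z. \<forall>x\<in>dom T. cinner (the (T x)) y = cinner x z)
     else None)"

definition self_adjoint :: "'a::complex_hilbert operator \<Rightarrow> bool" where
  "self_adjoint T \<longleftrightarrow>
    linear_operator T \<and> closure (dom T) = UNIV \<and> adjoint_operator T = T"

definition symmetric_operator :: "'a::complex_hilbert operator \<Rightarrow> bool" where
  "symmetric_operator T \<longleftrightarrow>
    (\<forall>x\<in>dom T. \<forall>y\<in>dom T. cinner (the (T x)) y = cinner x (the (T y)))"

definition bounded_below :: "'a::complex_hilbert operator \<Rightarrow> bool" where
  "bounded_below T \<longleftrightarrow>
    (\<exists>c. \<forall>x\<in>dom T. complex_of_real (c * (norm x)\<^sup>2) \<le> cinner (the (T x)) x)"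

text \<open>\<open>z\<close> is in the resolvent set iff \<open>T - z\<close> is a bijection of \<open>dom T\<close> onto the whole space
  whose inverse is bounded.\<close>

definition resolvent_set :: "'a::complex_hilbert operator \<Rightarrow> complex set" where
  "resolvent_set T = {z. bij_betw (\<lambda>x. the (T x) - z *\<^sub>C x) (dom T) UNIV \<and>
     (\<exists>C. \<forall>x\<in>dom T. norm x \<le> C * norm (the (T x) - z *\<^sub>C x))}"

definition spectrum :: "'a::complex_hilbert operator \<Rightarrow> complex set" where
  "spectrum T = - resolvent_set T"

definition eigenspace :: "'a::complex_hilbert operator \<Rightarrow> complex \<Rightarrow> 'a set" where
  "eigenspace T z = {x \<in> dom T. the (T x) = z *\<^sub>C x}"

definition purely_discrete_spectrum :: "'a::complex_hilbert operator \<Rightarrow> bool" where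
  "purely_discrete_spectrum T \<longleftrightarrow>
    (\<forall>z\<in>spectrum T. z isolated_in spectrum T \<and> eigenspace T z \<noteq> {0} \<and>
      (\<exists>B. finite B \<and> eigenspace T z \<subseteq> cspan B))"


section \<open>Commutators\<close>

definition commutator :: "'a::complex_hilbert operator \<Rightarrow> 'a operator \<Rightarrow> 'a operator" where
  "commutator A B = (\<lambda>x. case ((A \<circ>\<^sub>m B) x, (B \<circ>\<^sub>m A) x) of
     (Some y, Some z) \<Rightarrow> Some (y - z) | _ \<Rightarrow> None)"

definition operators_commute :: "'a::complex_hilbert operator \<Rightarrow> 'a operator \<Rightarrow> bool" where
  "operators_commute A B \<longleftrightarrow> (\<forall>x\<in>dom (commutator A B). the (commutator A B x) = 0)"

text \<open>The quadratic form \<open>\<langle>[A,[B,A]]u,u\<rangle> = \<langle>A[B,A]u,u\<rangle> - (\<langle>BAAu,u\<rangle> - \<langle>ABAu,u\<rangle>)\<close> of the double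
  commutator, where \<open>\<langle>A[B,A]u,u\<rangle>\<close> and \<open>\<langle>ABAu,u\<rangle>\<close> are understood as \<open>\<langle>[B,A]u,Au\<rangle>\<close> and
  \<open>\<langle>BAu,Au\<rangle>\<close>. It makes sense as soon as \<open>Au\<close> and \<open>AAu\<close> are in the domain of \<open>B\<close> and
  \<open>Bu\<close> in that of \<open>A\<close>; the operator product \<open>ABA\<close> would in addition require \<open>BAu\<close> to be in the
  domain of \<open>A\<close>. If \<open>A\<close> is symmetric, the two readings agree whenever the latter
  makes sense, see below.\<close>

definition double_commutator_form ::
    "'a::complex_hilbert operator \<Rightarrow> 'a operator \<Rightarrow> 'a \<Rightarrow> complex" where
  "double_commutator_form A B u =
     cinner (the (commutator B A u)) (the (A u))
     - (cinner (the ((B \<circ>\<^sub>m (A \<circ>\<^sub>m A)) u)) u - cinner (the ((B \<circ>\<^sub>m A) u)) (the (A u)))"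

lemma double_commutator_form_eq:
  fixes A B :: "'a::complex_hilbert operator"
  assumes sym: "symmetric_operator A"
    and dom: "u \<in> dom (commutator A (commutator B A))"
  shows "double_commutator_form A B u = cinner (the (commutator A (commutator B A) u)) u"
proof -
  have diff: "cinner (x - y) z = cinner x z - cinner y z" for x y z :: 'a
    using cinner_add_left[of "x - y" y z] by (simp add: algebra_simps)
  obtain v w b where v: "A u = Some v" and w: "B v = Some w" and b: "B u = Some b"
    using dom by (auto simp: commutator_def map_comp_def split: option.splits)
  have move: "cinner (the (A x)) u = cinner x v" if "x \<in> dom A" for x
    using sym that v by (auto simp: symmetric_operator_def domI)
  show ?thesis
    using dom v w b
    by (auto simp: double_commutator_form_def commutator_def map_comp_def diff
        move[symmetric, OF domI] split: option.splits)
qed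


section \<open>Analytic families\<close>

definition real_analytic :: "(real \<Rightarrow> 'b::real_normed_vector) \<Rightarrow> bool" where
  "real_analytic f \<longleftrightarrow>
    (\<forall>t. \<exists>a r. r > 0 \<and> (\<forall>s. \<bar>s - t\<bar> < r \<longrightarrow> (\<lambda>n. (s - t) ^ n *\<^sub>R a n) sums f s))"

definition analytic_operator_family ::
    "(real \<Rightarrow> 'a::complex_hilbert operator) \<Rightarrow> 'a set \<Rightarrow> bool" where
  "analytic_operator_family H D \<longleftrightarrow>
    (\<forall>t. self_adjoint (H t) \<and> dom (H t) = D) \<and> (\<forall>\<psi>\<in>D. real_analytic (\<lambda>t. the (H t \<psi>)))"

text \<open>The strong derivative of a family of operators, defined at \<open>\<psi>\<close> iff \<open>t \<mapsto> H t \<psi>\<close> is defined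
  near \<open>\<tau>\<close> and differentiable at \<open>\<tau>\<close>.\<close>

definition op_deriv :: "(real \<Rightarrow> 'a::complex_hilbert operator) \<Rightarrow> real \<Rightarrow> 'a operator" where
  "op_deriv H \<tau> = (\<lambda>\<psi>.
     if (\<forall>\<^sub>F t in nhds \<tau>. \<psi> \<in> dom (H t)) \<and> (\<lambda>t. the (H t \<psi>)) differentiable (at \<tau>)
     then Some (vector_derivative (\<lambda>t. the (H t \<psi>)) (at \<tau>))
     else None)"

end

theory Submission
  imports Defs
begin

text \<open>Differentiating \<open>\<langle>(H(t) - \<lambda>\<^sub>j(t)) u\<^sub>k(\<tau>), u\<^sub>j(t)\<rangle> = 0\<close> once and twice at \<open>t = \<tau>\<close>, where only the
  vector \<open>u\<^sub>k(\<tau>)\<close> in the operator's argument is kept fixed, avoids the question whether the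
  derivative of \<open>u\<^sub>j\<close> lies in the domain. Together with Parseval's identity this gives
  second-order perturbation theory
  \<open>\<langle>H'' u\<^sub>j, u\<^sub>j\<rangle> - \<lambda>\<^sub>j'' = 2 \<Sum>\<^sub>k |a\<^sub>j\<^sub>k|\<^sup>2 / (\<lambda>\<^sub>k - \<lambda>\<^sub>j)\<close> with \<open>a\<^sub>j\<^sub>k = \<langle>H' u\<^sub>j, u\<^sub>k\<rangle>\<close>,
  and \<open>a\<^sub>j\<^sub>k = 0\<close> if \<open>\<lambda>\<^sub>j = \<lambda>\<^sub>k\<close> with \<open>j \<noteq> k\<close>. The double commutator is
  \<open>2 \<Sum>\<^sub>k (\<lambda>\<^sub>k - \<lambda>\<^sub>j) |a\<^sub>j\<^sub>k|\<^sup>2\<close>. Summed over \<open>\<lambda>\<^sub>j \<in> J\<close>, the terms with \<open>\<lambda>\<^sub>k \<in> J\<close> cancel by antisymmetry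
  in both expressions, and in the remaining ones \<open>\<lambda>\<^sub>k - \<lambda>\<^sub>j \<ge> d > 0\<close>, so that
  \<open>0 < 1 / (\<lambda>\<^sub>k - \<lambda>\<^sub>j) \<le> (\<lambda>\<^sub>k - \<lambda>\<^sub>j) / d\<^sup>2\<close>.\<close>

section \<open>The complex inner product\<close>

subclass (in complex_hilbert) banach ..

lemma cinner_add_right: "cinner x (y + z) = cinner x y + cinner x z"
  by (metis cinner_add_left cinner_commute complex_cnj_add)

lemma cinner_scaleC_right: "cinner x (c *\<^sub>C y) = cnj c * cinner x y"
  by (metis cinner_commute cinner_scaleC_left complex_cnj_mult)

lemma cinner_scaleR_left: "cinner (r *\<^sub>R x) y = of_real r * cinner x y"
  by (simp add: scaleR_eq_scaleC cinner_scaleC_left)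

lemma cinner_scaleR_right: "cinner x (r *\<^sub>R y) = of_real r * cinner x y"
  by (simp add: scaleR_eq_scaleC cinner_scaleC_right)

lemma norm_scaleC_imaginary_unit: "norm (\<i> *\<^sub>C x) = norm x" for x :: "'a::complex_hilbert"
  by (simp add: norm_eq inner_eq_Re_cinner cinner_scaleC_left cinner_scaleC_right)

text \<open>The real Cauchy-Schwarz inequality bounds the real part and, applied to
  \<open>\<i> *\<^sub>C y\<close>, the imaginary part; adding the two bounds gives the factor
  2.\<close>

lemma norm_cinner_le: "norm (cinner x y) \<le> norm x * norm y * 2"
proof -
  have "\<bar>Re (cinner x y)\<bar> \<le> norm x * norm y"
    using Cauchy_Schwarz_ineq2[of x y] by (simp add: inner_eq_Re_cinner)
  moreover have "\<bar>Im (cinner x y)\<bar> \<le> norm x * norm y"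
    using Cauchy_Schwarz_ineq2[of x "\<i> *\<^sub>C y"]
    by (simp add: inner_eq_Re_cinner cinner_scaleC_right norm_scaleC_imaginary_unit)
  ultimately show ?thesis
    using cmod_le[of "cinner x y"] by linarith
qed

lemma bounded_bilinear_cinner: "bounded_bilinear (cinner :: 'a::complex_hilbert \<Rightarrow> 'a \<Rightarrow> complex)"
  by unfold_locales
    (auto simp: cinner_add_left cinner_add_right cinner_scaleR_left cinner_scaleR_right
        scaleR_conv_of_real intro!: exI[of _ 2] norm_cinner_le)

lemmas cinner_diff_left = bounded_bilinear.diff_left[OF bounded_bilinear_cinner]
  and cinner_sum_left = bounded_bilinear.sum_left[OF bounded_bilinear_cinner]
  and cinner_sum_right = bounded_bilinear.sum_right[OF bounded_bilinear_cinner]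
  and cinner_zero_left = bounded_bilinear.zero_left[OF bounded_bilinear_cinner]
  and has_vector_derivative_cinner =
    bounded_bilinear.has_vector_derivative[OF bounded_bilinear_cinner]

text \<open>The partial sums \<open>p n\<close> fix each vector of the span from some
  \<open>n\<close> on, and \<open>w - p n w\<close> is never longer than \<open>w\<close>; density
  of the span then gives convergence everywhere.\<close>

lemma orthonormal_basis_expansion:
  fixes u :: "nat \<Rightarrow> 'a::complex_hilbert"
  assumes "orthonormal_basis u"
  shows "(\<lambda>k. cinner x (u k) *\<^sub>C u k) sums x"
proof -
  have ortho: "cinner (u j) (u k) = (if j = k then 1 else 0)" for j k
    using assms by (auto simp: orthonormal_basis_def)
  have dense: "closure (cspan (range u)) = UNIV"
    using assms by (auto simp: orthonormal_basis_def)
  define p where "p n z = (\<Sum>k<n. cinner z (u k) *\<^sub>C u k)" for n z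
  have p_add: "p n (y + z) = p n y + p n z" for n y z
    by (simp add: p_def cinner_add_left scaleC_add_left sum.distrib)
  have p_scale: "p n (c *\<^sub>C z) = c *\<^sub>C p n z" for n c z
    by (simp add: p_def cinner_scaleC_left complex_space.scale_sum_right)
  have fixed: "\<exists>N. \<forall>n\<ge>N. p n z = z" if "z \<in> cspan (range u)" for z
    using that
  proof (induction rule: complex_space.span_induct_alt)
    case base
    then show ?case by (simp add: p_def cinner_zero_left)
  next
    case (step c y z)
    then obtain k N where k: "y = u k" and N: "\<And>n. n \<ge> N \<Longrightarrow> p n z = z"
      by auto
    have "p n (u k) = u k" if "n > k" for n
    proof -
      have "p n (u k) = (\<Sum>i<n. if i = k then u k else 0)"
        unfolding p_def by (rule sum.cong) (auto simp: ortho)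
      then show ?thesis using that by simp
    qed
    then have "p n (c *\<^sub>C y + z) = c *\<^sub>C y + z" if "n \<ge> max N (Suc k)" for n
      using that N by (simp add: p_add p_scale k)
    then show ?case by blast
  qed
  have contr: "norm (w - p n w) \<le> norm w" for n w
  proof -
    have "cinner (p n w) (u k) = cinner w (u k)" if "k < n" for k
      using that by (simp add: p_def cinner_sum_left cinner_scaleC_left ortho if_distrib cong: if_cong)
    then have "cinner (w - p n w) (u k) = 0" if "k < n" for k
      using that by (simp add: cinner_diff_left)
    then have "cinner (w - p n w) (p n w) = 0"
      by (subst (2) p_def) (simp add: cinner_sum_right cinner_scaleC_right)
    then have "orthogonal (w - p n w) (p n w)"
      by (simp add: orthogonal_def inner_eq_Re_cinner)
    from norm_add_Pythagorean[OF this]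
    have "(norm (w - p n w))\<^sup>2 \<le> (norm w)\<^sup>2" by simp
    then show ?thesis by (rule power2_le_imp_le) simp
  qed
  have "(\<lambda>n. p n x) \<longlonglongrightarrow> x"
  proof (rule LIMSEQ_I)
    fix e :: real assume "e > 0"
    then obtain z where z: "z \<in> cspan (range u)" "dist z x < e"
      using dense closure_approachable[of x "cspan (range u)"] by blast
    then obtain N where N: "\<And>n. n \<ge> N \<Longrightarrow> p n z = z" using fixed by blast
    have "norm (p n x - x) < e" if "n \<ge> N" for n
    proof -
      \<comment> \<open>As \<open>p n\<close> fixes \<open>z\<close>, the error at \<open>x\<close>
        equals the error at the short vector \<open>x - z\<close>.\<close>
      have "p n x = z + p n (x - z)" using p_add[of n z "x - z"] N[OF that] by simp
      then have "norm (p n x - x) = norm ((x - z) - p n (x - z))"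
        by (subst norm_minus_commute) (simp add: algebra_simps)
      also have "\<dots> \<le> norm (x - z)" by (rule contr)
      also have "\<dots> < e" using z by (simp add: dist_norm norm_minus_commute)
      finally show ?thesis .
    qed
    then show "\<exists>N. \<forall>n\<ge>N. norm (p n x - x) < e" by blast
  qed
  then show ?thesis by (simp add: sums_def p_def)
qed

lemma parseval:
  fixes u :: "nat \<Rightarrow> 'a::complex_hilbert"
  assumes "orthonormal_basis u"
  shows "(\<lambda>k. cinner x (u k) * cinner (u k) y) sums cinner x y"
  using bounded_linear.sums[OF bounded_bilinear.bounded_linear_left[OF bounded_bilinear_cinner]
      orthonormal_basis_expansion[OF assms, of x], of y]
  by (simp add: cinner_scaleC_left)


section \<open>Differentiation\<close>

text \<open>Abel's lemma: the terms at \<open>y\<close> are bounded, which leaves a geometric series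
  with ratio \<open>\<bar>x\<bar> / y\<close>.\<close>

lemma power_series_norm_summable:
  fixes a :: "nat \<Rightarrow> 'b::real_normed_vector"
  assumes "summable (\<lambda>n. y ^ n *\<^sub>R a n)" and x: "\<bar>x\<bar> < y"
  shows "summable (\<lambda>n. norm (a n) * x ^ n)"
proof -
  have "y > 0" using x by linarith
  have "Bseq (\<lambda>n. y ^ n *\<^sub>R a n)"
    using summable_LIMSEQ_zero[OF assms(1)] convergent_def convergent_imp_Bseq by blast
  then obtain K where K: "\<And>n. norm (y ^ n *\<^sub>R a n) \<le> K" by (auto simp: Bseq_def)
  show ?thesis
  proof (rule summable_comparison_test')
    show "summable (\<lambda>n. K * (\<bar>x\<bar> / y) ^ n)"
      using x by (intro summable_mult summable_geometric) auto
    fix n :: nat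
    have "norm (norm (a n) * x ^ n) = norm (y ^ n *\<^sub>R a n) * (\<bar>x\<bar> / y) ^ n"
      using \<open>y > 0\<close> by (simp add: abs_mult power_abs power_divide)
    also have "\<dots> \<le> K * (\<bar>x\<bar> / y) ^ n"
      using x by (intro mult_right_mono K) auto
    finally show "norm (norm (a n) * x ^ n) \<le> K * (\<bar>x\<bar> / y) ^ n" .
  qed
qed

text \<open>Termwise differentiation on a slightly smaller ball, where the series of derivatives
  converges uniformly by the Weierstrass test. The series of the derivative is part of the
  conclusion so that the argument can be iterated.\<close>

lemma power_series_has_vector_derivative:
  fixes a :: "nat \<Rightarrow> 'b::banach" and f :: "real \<Rightarrow> 'b"
  assumes f: "\<And>s. \<bar>s - t\<bar> < r \<Longrightarrow> (\<lambda>n. (s - t) ^ n *\<^sub>R a n) sums f s"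
    and s: "\<bar>s - t\<bar> < r"
  obtains f' where "(f has_vector_derivative f') (at s)"
    "(\<lambda>n. (s - t) ^ n *\<^sub>R (real (Suc n) *\<^sub>R a (Suc n))) sums f'"
proof -
  \<comment> \<open>The midpoint of \<open>\<bar>s - t\<bar>\<close> and \<open>r\<close> puts
    \<open>s\<close> in the interior of a closed ball on which the series converges.\<close>
  define \<rho> where "\<rho> = (\<bar>s - t\<bar> + r) / 2"
  have \<rho>: "\<bar>s - t\<bar> < \<rho>" "0 < \<rho>" "\<rho> < r" using s by (auto simp: \<rho>_def)
  define b where "b n = real (Suc n) *\<^sub>R a (Suc n)" for n
  have norm_summable: "summable (\<lambda>n. norm (a n) * x ^ n)" if "norm x < r" for x :: real
    using that f[of "t + (\<bar>x\<bar> + r) / 2"]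
    by (intro power_series_norm_summable[of "(\<bar>x\<bar> + r) / 2"]) (auto simp: sums_iff)
  have b_summable: "summable (\<lambda>n. norm (b n) * \<rho> ^ n)"
    using termdiff_converges[of \<rho> r "\<lambda>n. norm (a n)"] norm_summable \<rho>
    by (simp add: diffs_def b_def)
  \<comment> \<open>\<open>D n\<close> is the derivative of the term of index \<open>n\<close>; the
    constant term contributes 0, whence the shift of \<open>b\<close> by one.\<close>
  define D where "D n x = (if n = 0 then 0 else (x - t) ^ (n - 1) *\<^sub>R b (n - 1))" for n x
  define M where "M n = (if n = 0 then 0 else norm (b (n - 1)) * \<rho> ^ (n - 1))" for n
  have M: "summable M"
    using b_summable by (subst summable_Suc_iff[symmetric]) (simp add: M_def)
  have D_le: "norm (D n x) \<le> M n" if "x \<in> cball t \<rho>" for n x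
    using that mult_right_mono[OF power_mono[of "\<bar>x - t\<bar>" \<rho> "n - 1"], of "norm (b (n - 1))"]
    by (simp add: D_def M_def power_abs mult.commute dist_real_def abs_minus_commute)
  have unif: "uniform_limit (cball t \<rho>) (\<lambda>n x. \<Sum>i<n. D i x) (\<lambda>x. \<Sum>n. D n x) sequentially"
    by (rule Weierstrass_m_test[OF D_le M])
  have "\<exists>g. \<forall>x\<in>cball t \<rho>. (\<lambda>n. (x - t) ^ n *\<^sub>R a n) sums g x \<and>
      (g has_derivative (\<lambda>h. h *\<^sub>R (\<Sum>n. D n x))) (at x within cball t \<rho>)"
  proof (rule has_derivative_series)
    show "((\<lambda>x. (x - t) ^ n *\<^sub>R a n) has_derivative (\<lambda>h. h *\<^sub>R D n x)) (at x within cball t \<rho>)"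
      for n x
    proof (cases n)
      case (Suc m)
      have "((\<lambda>x. (x - t) ^ n) has_real_derivative real (Suc m) * (x - t) ^ m)
          (at x within cball t \<rho>)"
        using DERIV_power[OF DERIV_diff[OF DERIV_ident DERIV_const[of t]], where n = n]
        by (simp add: Suc)
      from has_derivative_scaleR_left[OF this[unfolded has_field_derivative_def], of "a n"]
      show ?thesis
        by (simp add: D_def b_def Suc mult_ac)
    qed (simp add: D_def)
    show "\<forall>\<^sub>F n in sequentially. \<forall>x\<in>cball t \<rho>. \<forall>h.
        norm ((\<Sum>i<n. h *\<^sub>R D i x) - h *\<^sub>R (\<Sum>n. D n x)) \<le> e * norm h" if "e > 0" for e
      using uniform_limitD[OF unif that]
    proof eventually_elim
      case (elim n)
      show ?case
      proof (intro ballI allI)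
        fix x h :: real assume "x \<in> cball t \<rho>"
        then have "norm ((\<Sum>i<n. D i x) - (\<Sum>n. D n x)) \<le> e"
          using elim by (auto simp: dist_norm less_imp_le)
        then have "norm h * norm ((\<Sum>i<n. D i x) - (\<Sum>n. D n x)) \<le> norm h * e"
          by (intro mult_left_mono) auto
        then show "norm ((\<Sum>i<n. h *\<^sub>R D i x) - h *\<^sub>R (\<Sum>n. D n x)) \<le> e * norm h"
          by (simp add: scaleR_sum_right[symmetric] scaleR_diff_right[symmetric] mult.commute)
      qed
    qed
    show "t \<in> cball t \<rho>" "(\<lambda>n. (t - t) ^ n *\<^sub>R a n) sums f t"
      using f[of t] s \<rho> by auto
  qed auto
  then obtain g where g: "\<And>x. x \<in> cball t \<rho> \<Longrightarrow> (\<lambda>n. (x - t) ^ n *\<^sub>R a n) sums g x"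
    "\<And>x. x \<in> cball t \<rho> \<Longrightarrow> (g has_derivative (\<lambda>h. h *\<^sub>R (\<Sum>n. D n x))) (at x within cball t \<rho>)"
    by blast
  have s_in: "s \<in> ball t \<rho>" using \<rho> by (simp add: dist_real_def abs_minus_commute)
  \<comment> \<open>Passing to the open ball turns the derivative within a set into a derivative at
    \<open>s\<close>.\<close>
  have "(g has_vector_derivative (\<Sum>n. D n s)) (at s within ball t \<rho>)"
    unfolding has_vector_derivative_def
    using s_in by (intro has_derivative_subset[OF g(2)]) auto
  then have "(g has_vector_derivative (\<Sum>n. D n s)) (at s)"
    by (simp only: at_within_open[OF s_in open_ball])
  moreover have "g x = f x" if "x \<in> ball t \<rho>" for x
    using that \<rho> g(1)[of x] f[of x] by (auto simp: dist_real_def abs_minus_commute intro: sums_unique2)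
  ultimately have "(f has_vector_derivative (\<Sum>n. D n s)) (at s)"
    using s_in has_vector_derivative_transform_within_open[of g _ s "ball t \<rho>" f] by auto
  moreover have "(\<lambda>n. D n s) sums (\<Sum>n. D n s)"
    using s_in by (intro summable_sums summable_comparison_test'[OF M] D_le) auto
  then have "(\<lambda>n. (s - t) ^ n *\<^sub>R (real (Suc n) *\<^sub>R a (Suc n))) sums (\<Sum>n. D n s)"
    using sums_Suc_iff[of "\<lambda>n. D n s" "\<Sum>n. D n s"] by (simp add: D_def b_def)
  ultimately show thesis by (rule that)
qed

lemma real_analytic_has_derivative:
  fixes f :: "real \<Rightarrow> 'b::banach"
  assumes "real_analytic f"
  obtains f' where "\<And>t. (f has_vector_derivative f' t) (at t)" "real_analytic f'"
proof -
  \<comment> \<open>One global function is fixed first, so that the series around different centres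
    all sum to values of the same derivative.\<close>
  define f' where "f' t = vector_derivative f (at t)" for t
  have *: "\<exists>a r. r > 0 \<and> (\<forall>s. \<bar>s - t\<bar> < r \<longrightarrow>
      (f has_vector_derivative f' s) (at s) \<and> (\<lambda>n. (s - t) ^ n *\<^sub>R a n) sums f' s)" for t
  proof -
    obtain a r where "r > 0" and a: "\<And>s. \<bar>s - t\<bar> < r \<Longrightarrow> (\<lambda>n. (s - t) ^ n *\<^sub>R a n) sums f s"
      using assms unfolding real_analytic_def by metis
    have "(f has_vector_derivative f' s) (at s) \<and>
        (\<lambda>n. (s - t) ^ n *\<^sub>R (real (Suc n) *\<^sub>R a (Suc n))) sums f' s" if "\<bar>s - t\<bar> < r" for s
      using power_series_has_vector_derivative[OF a that]
      by (metis f'_def vector_derivative_at)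
    with \<open>r > 0\<close> show ?thesis
      by (intro exI[of _ "\<lambda>n. real (Suc n) *\<^sub>R a (Suc n)"] exI[of _ r]) simp
  qed
  show thesis
  proof
    show "(f has_vector_derivative f' t) (at t)" for t
      using *[of t] by auto
    show "real_analytic f'"
      unfolding real_analytic_def using * by meson
  qed
qed

text \<open>The product rule, applied twice to a function that vanishes identically. The derivative
  of \<open>g\<close> is asked for only near \<open>\<tau>\<close>, which is what membership in the
  domain of a second strong derivative provides.\<close>

lemma cinner_zero_derivatives:
  fixes g u :: "real \<Rightarrow> 'a::complex_hilbert"
  assumes zero: "\<And>t. cinner (g t) (u t) = 0"
    and g: "\<forall>\<^sub>F t in nhds \<tau>. (g has_vector_derivative g1 t) (at t)"
    and g1: "(g1 has_vector_derivative g2) (at \<tau>)"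
    and u: "\<And>t. (u has_vector_derivative u1 t) (at t)"
    and u1: "(u1 has_vector_derivative u2) (at \<tau>)"
  shows "cinner (g1 \<tau>) (u \<tau>) + cinner (g \<tau>) (u1 \<tau>) = 0"
    and "cinner g2 (u \<tau>) + 2 * cinner (g1 \<tau>) (u1 \<tau>) + cinner (g \<tau>) u2 = 0"
proof -
  have const: "((\<lambda>t. cinner (g t) (u t)) has_vector_derivative 0) (at t)" for t
    by (simp add: zero)
  let ?F = "\<lambda>t. cinner (g t) (u1 t) + cinner (g1 t) (u t)"
  \<comment> \<open>The first-order identity is established in a neighbourhood of
    \<open>\<tau>\<close>, since it is differentiated once more below.\<close>
  have F: "\<forall>\<^sub>F t in nhds \<tau>. ?F t = 0"
    using g
  proof eventually_elim
    case (elim t)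
    show ?case
      by (rule vector_derivative_unique_at[OF has_vector_derivative_cinner[OF elim u] const])
  qed
  then have "?F \<tau> = 0" by (rule eventually_nhds_x_imp_x)
  then show "cinner (g1 \<tau>) (u \<tau>) + cinner (g \<tau>) (u1 \<tau>) = 0" by (simp add: add.commute)
  have g\<tau>: "(g has_vector_derivative g1 \<tau>) (at \<tau>)"
    using g by (rule eventually_nhds_x_imp_x)
  have "(?F has_vector_derivative (cinner (g \<tau>) u2 + cinner (g1 \<tau>) (u1 \<tau>)
      + (cinner (g1 \<tau>) (u1 \<tau>) + cinner g2 (u \<tau>)))) (at \<tau>)"
    by (intro has_vector_derivative_add has_vector_derivative_cinner g\<tau> g1 u u1)
  moreover have "(?F has_vector_derivative 0) (at \<tau>)"
  proof -
    obtain S where "open S" "\<tau> \<in> S" "\<And>t. t \<in> S \<Longrightarrow> ?F t = 0"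
      using F by (auto simp: eventually_nhds)
    then show ?thesis
      by (intro has_vector_derivative_transform_within_open[of "\<lambda>_. 0" 0 \<tau> S ?F]) auto
  qed
  ultimately have "cinner (g \<tau>) u2 + cinner (g1 \<tau>) (u1 \<tau>)
      + (cinner (g1 \<tau>) (u1 \<tau>) + cinner g2 (u \<tau>)) = 0"
    by (rule vector_derivative_unique_at)
  then show "cinner g2 (u \<tau>) + 2 * cinner (g1 \<tau>) (u1 \<tau>) + cinner (g \<tau>) u2 = 0"
    by (simp add: algebra_simps)
qed


section \<open>Operators\<close>

text \<open>The value of the adjoint is a chosen \<open>z\<close> with the defining property, and
  \<open>y \<in> dom T\<close> ensures that such a \<open>z\<close> exists.\<close>

lemma self_adjoint_symmetric:
  assumes "self_adjoint T"
  shows "symmetric_operator T"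
  unfolding symmetric_operator_def
proof (intro ballI)
  fix x y assume x: "x \<in> dom T" and y: "y \<in> dom T"
  have T: "adjoint_operator T = T" using assms by (simp add: self_adjoint_def)
  define P where "P z \<longleftrightarrow> (\<forall>x\<in>dom T. cinner (the (T x)) y = cinner x z)" for z
  have adj: "T y = (if \<exists>z. P z then Some (SOME z. P z) else None)"
    unfolding P_def by (subst T[symmetric]) (simp add: adjoint_operator_def)
  then have "\<exists>z. P z" using y by (auto split: if_splits)
  then have "P (the (T y))" using adj by (simp add: someI_ex)
  then show "cinner (the (T x)) y = cinner x (the (T y))" using x by (simp add: P_def)
qed

lemma op_deriv_derivative:
  assumes "x \<in> dom (op_deriv H \<tau>)"
  shows "((\<lambda>t. the (H t x)) has_vector_derivative the (op_deriv H \<tau> x)) (at \<tau>)"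
  using assms by (auto simp: op_deriv_def vector_derivative_works split: if_splits)

lemma op_deriv_dom_eventually:
  assumes "x \<in> dom (op_deriv H \<tau>)"
  shows "\<forall>\<^sub>F t in nhds \<tau>. x \<in> dom (H t)"
  using assms by (auto simp: op_deriv_def split: if_splits)

text \<open>Both sides of the symmetry relation of \<open>H t\<close> have a derivative at
  \<open>\<tau>\<close>, and they agree near \<open>\<tau>\<close>, where both vectors lie in the
  domain of \<open>H t\<close>.\<close>

lemma op_deriv_symmetric:
  assumes sym: "\<And>t. symmetric_operator (H t)"
  shows "symmetric_operator (op_deriv H \<tau>)"
  unfolding symmetric_operator_def
proof (intro ballI)
  fix x y assume x: "x \<in> dom (op_deriv H \<tau>)" and y: "y \<in> dom (op_deriv H \<tau>)"
  have "((\<lambda>t. cinner (the (H t x)) y) has_vector_derivative cinner (the (op_deriv H \<tau> x)) y) (at \<tau>)"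
    using has_vector_derivative_cinner[OF op_deriv_derivative[OF x] has_vector_derivative_const[of y]]
    by (simp add: bounded_bilinear.zero_right[OF bounded_bilinear_cinner])
  moreover have "((\<lambda>t. cinner (the (H t x)) y) has_vector_derivative
      cinner x (the (op_deriv H \<tau> y))) (at \<tau>)"
  proof -
    have *: "((\<lambda>t. cinner x (the (H t y))) has_vector_derivative
        cinner x (the (op_deriv H \<tau> y))) (at \<tau>)"
      using has_vector_derivative_cinner[OF has_vector_derivative_const[of x] op_deriv_derivative[OF y]]
      by (simp add: cinner_zero_left)
    have "\<forall>\<^sub>F t in nhds \<tau>. cinner x (the (H t y)) = cinner (the (H t x)) y"
      using op_deriv_dom_eventually[OF x] op_deriv_dom_eventually[OF y]
      by eventually_elim (use sym in \<open>simp add: symmetric_operator_def\<close>)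
    then obtain S where "open S" "\<tau> \<in> S"
      "\<And>t. t \<in> S \<Longrightarrow> cinner x (the (H t y)) = cinner (the (H t x)) y"
      by (auto simp: eventually_nhds)
    with * show ?thesis by (rule has_vector_derivative_transform_within_open)
  qed
  ultimately show "cinner (the (op_deriv H \<tau> x)) y = cinner x (the (op_deriv H \<tau> y))"
    by (rule vector_derivative_unique_at)
qed


section \<open>Summation over a spectral cluster\<close>

text \<open>Over pairs of indices in \<open>I\<close> the double sum turns into its own negative
  when the indices are exchanged, so it vanishes and these finitely many terms may be deleted from
  the series.\<close>

lemma sums_antisymmetric_block:
  fixes f :: "nat \<Rightarrow> nat \<Rightarrow> real"
  assumes "finite I" and f: "\<And>j. j \<in> I \<Longrightarrow> f j sums s j"
    and anti: "\<And>j k. j \<in> I \<Longrightarrow> k \<in> I \<Longrightarrow> f k j = - f j k"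
  shows "(\<lambda>k. if k \<in> I then 0 else \<Sum>j\<in>I. f j k) sums (\<Sum>j\<in>I. s j)"
proof -
  define g where "g k = (\<Sum>j\<in>I. f j k)" for k
  have "(\<Sum>k\<in>I. g k) = (\<Sum>k\<in>I. \<Sum>j\<in>I. - f k j)"
    unfolding g_def by (intro sum.cong refl anti)
  also have "\<dots> = - (\<Sum>k\<in>I. g k)"
    unfolding g_def sum_negf by (subst sum.swap) (rule refl)
  finally have "(\<Sum>k\<in>I. g k) = 0" by simp
  moreover have "g sums (\<Sum>j\<in>I. s j)"
    unfolding g_def by (intro sums_sum f)
  ultimately have "(\<lambda>k. g k - (if k \<in> I then g k else 0)) sums ((\<Sum>j\<in>I. s j) - 0)"
    using sums_If_finite_set[OF \<open>finite I\<close>, of g] by (intro sums_diff) auto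
  moreover have "(\<lambda>k. g k - (if k \<in> I then g k else 0)) = (\<lambda>k. if k \<in> I then 0 else g k)"
    by auto
  ultimately show ?thesis unfolding g_def[symmetric] by simp
qed

text \<open>To be applied to the eigenvalues \<open>l\<close> and the squared matrix elements
  \<open>a\<close> of the derivative of \<open>H\<close>; \<open>s\<close> is then the quantity to
  be bounded and \<open>c\<close> the double commutator form. After the cancellation within
  \<open>I\<close> the two series are compared term by term.\<close>

lemma spectral_cluster_bounds:
  fixes a :: "nat \<Rightarrow> nat \<Rightarrow> real" and l :: "nat \<Rightarrow> real"
  assumes "finite I" and "d > 0"
    and gap: "\<And>j k. j \<in> I \<Longrightarrow> k \<notin> I \<Longrightarrow> d \<le> l k - l j"
    and a_sym: "\<And>j k. a j k = a k j" and a_nonneg: "\<And>j k. a j k \<ge> 0"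
    and s: "\<And>j. j \<in> I \<Longrightarrow> (\<lambda>k. 2 * a j k / (l k - l j)) sums s j"
    and c: "\<And>j. j \<in> I \<Longrightarrow> (\<lambda>k. 2 * (l k - l j) * a j k) sums c j"
  shows "0 \<le> (\<Sum>j\<in>I. s j)" and "(\<Sum>j\<in>I. s j) \<le> 1 / d\<^sup>2 * (\<Sum>j\<in>I. c j)"
proof -
  have S: "(\<lambda>k. if k \<in> I then 0 else \<Sum>j\<in>I. 2 * a j k / (l k - l j)) sums (\<Sum>j\<in>I. s j)"
  proof (intro sums_antisymmetric_block \<open>finite I\<close> s)
    \<comment> \<open>The sign moves through the denominator, also when both quotients are 0 because
      \<open>l k = l j\<close>.\<close>
    show "2 * a k j / (l j - l k) = - (2 * a j k / (l k - l j))" for j k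
      using a_sym[of k j] by (metis minus_diff_eq minus_divide_right)
  qed
  have C: "(\<lambda>k. if k \<in> I then 0 else \<Sum>j\<in>I. 2 * (l k - l j) * a j k) sums (\<Sum>j\<in>I. c j)"
  proof (intro sums_antisymmetric_block \<open>finite I\<close> c)
    show "2 * (l j - l k) * a k j = - (2 * (l k - l j) * a j k)" for j k
      by (simp add: a_sym[of k j] algebra_simps)
  qed
  have pos: "l k - l j > 0" if "j \<in> I" "k \<notin> I" for j k
    using gap[OF that] \<open>d > 0\<close> by linarith
  show "0 \<le> (\<Sum>j\<in>I. s j)"
    by (rule sums_le[OF _ sums_zero S])
      (auto intro!: sum_nonneg divide_nonneg_pos a_nonneg pos)
  have le: "2 * a j k / (l k - l j) \<le> 1 / d\<^sup>2 * (2 * (l k - l j) * a j k)"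
    if "j \<in> I" "k \<notin> I" for j k
  proof -
    have "d\<^sup>2 \<le> (l k - l j)\<^sup>2" using gap[OF that] \<open>d > 0\<close> by (intro power_mono) auto
    \<comment> \<open>Expanding the fraction by \<open>l k - l j\<close> makes the denominator a
      square, comparable with \<open>d\<^sup>2\<close>.\<close>
    have "2 * a j k / (l k - l j) = 2 * a j k * (l k - l j) / (l k - l j)\<^sup>2"
      using pos[OF that] by (simp add: power2_eq_square)
    also have "\<dots> \<le> 2 * a j k * (l k - l j) / d\<^sup>2"
      using \<open>d\<^sup>2 \<le> (l k - l j)\<^sup>2\<close> pos[OF that] \<open>d > 0\<close> a_nonneg[of j k]
      by (intro divide_left_mono) auto
    also have "\<dots> = 1 / d\<^sup>2 * (2 * (l k - l j) * a j k)"
      by simp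
    finally show ?thesis .
  qed
  show "(\<Sum>j\<in>I. s j) \<le> 1 / d\<^sup>2 * (\<Sum>j\<in>I. c j)"
  proof (rule sums_le[OF _ S sums_mult[OF C]])
    fix k
    have "(\<Sum>j\<in>I. 2 * a j k / (l k - l j)) \<le> 1 / d\<^sup>2 * (\<Sum>j\<in>I. 2 * (l k - l j) * a j k)"
      if "k \<notin> I"
      unfolding sum_distrib_left using that by (intro sum_mono le)
    then show "(if k \<in> I then 0 else \<Sum>j\<in>I. 2 * a j k / (l k - l j))
        \<le> 1 / d\<^sup>2 * (if k \<in> I then 0 else \<Sum>j\<in>I. 2 * (l k - l j) * a j k)" by simp
  qed
qed


theorem theorem1p9:
  fixes H :: "real \<Rightarrow> 'a::complex_hilbert operator"
    and D :: "'a set"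
    and ev :: "nat \<Rightarrow> real \<Rightarrow> real"
    and u :: "nat \<Rightarrow> real \<Rightarrow> 'a"
    and \<tau> d :: real
    and J Jc :: "real set"
    and H1 H2 :: "'a operator"
  assumes family: "analytic_operator_family H D"
    and below: "\<And>t. bounded_below (H t)"
    and discrete: "\<And>t. purely_discrete_spectrum (H t)"
    and spectrum: "\<And>t. spectrum (H t) = complex_of_real ` range (\<lambda>j. ev j t)"
    and ev_analytic: "\<And>j. real_analytic (ev j)"
    and u_analytic: "\<And>j. real_analytic (u j)"
    and eigen: "\<And>j t. u j t \<in> D \<and> the (H t (u j t)) = ev j t *\<^sub>R u j t"
    and basis: "\<And>t. orthonormal_basis (\<lambda>j. u j t)"
    and H1: "H1 = op_deriv H \<tau>"
    and H2: "H2 = op_deriv (op_deriv H) \<tau>"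
    and H1_dom: "D \<subseteq> dom H1" and H1_maps: "\<And>\<psi>. \<psi> \<in> D \<Longrightarrow> the (H1 \<psi>) \<in> D"
    and H2_dom: "D \<subseteq> dom H2" and H2_maps: "\<And>\<psi>. \<psi> \<in> D \<Longrightarrow> the (H2 \<psi>) \<in> D"
    and J: "complex_of_real ` J \<subseteq> spectrum (H \<tau>)"
    and Jc: "Jc = {\<mu>. complex_of_real \<mu> \<in> spectrum (H \<tau>)} - J"
    and gap: "ereal d = (INF \<mu>\<in>Jc. ereal \<mu>) - (SUP \<mu>\<in>J. ereal \<mu>)" and d_pos: "d > 0"
    and H1_u: "\<And>j. u j \<tau> \<in> dom (H \<tau> \<circ>\<^sub>m H1)"
    and H1_H1_u: "\<And>j. u j \<tau> \<in> dom (H \<tau> \<circ>\<^sub>m (H1 \<circ>\<^sub>m H1))"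
  shows
    "let I = {j. ev j \<tau> \<in> J};
         S = (\<Sum>j\<in>I. cinner (the (H2 (u j \<tau>))) (u j \<tau>))
             - (\<Sum>j\<in>I. complex_of_real (deriv (deriv (ev j)) \<tau>))
     in 0 \<le> S
      \<and> S \<le> complex_of_real (1 / d\<^sup>2) * (\<Sum>j\<in>I. double_commutator_form H1 (H \<tau>) (u j \<tau>))
      \<and> ((\<forall>j\<in>I. u j \<tau> \<in> dom (commutator H1 (commutator (H \<tau>) H1))) \<longrightarrow>
          S \<le> complex_of_real (1 / d\<^sup>2) *
                (\<Sum>j\<in>I. cinner (the (commutator H1 (commutator (H \<tau>) H1) (u j \<tau>))) (u j \<tau>)))
      \<and> (operators_commute H1 (H \<tau>) \<longrightarrow>
          S = 0 \<and>
          (\<forall>j. complex_of_real (deriv (deriv (ev j)) \<tau>) = cinner (the (H2 (u j \<tau>))) (u j \<tau>)))"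
proof -

  \<comment> \<open>Operators and eigenvectors at the fixed parameter\<close>
  define l v A where "l j = ev j \<tau>" and "v j = u j \<tau>" and "A x = the (H1 x)" for j x
  define a where "a j k = (cmod (cinner (A (v j)) (v k)))\<^sup>2" for j k
  have sa: "self_adjoint (H t)" and dom_H: "dom (H t) = D" for t
    using family by (auto simp: analytic_operator_family_def)
  have H_sym: "cinner (the (H t x)) y = cinner x (the (H t y))" if "x \<in> D" "y \<in> D" for t x y
    using self_adjoint_symmetric[OF sa] that dom_H by (simp add: symmetric_operator_def)
  have H1_sym: "symmetric_operator H1"
    unfolding H1 by (intro op_deriv_symmetric self_adjoint_symmetric sa)
  then have A_sym: "cinner (A x) y = cinner x (A y)" if "x \<in> D" "y \<in> D" for x y
    using that H1_dom unfolding symmetric_operator_def A_def by blast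
  have A_maps: "A x \<in> D" if "x \<in> D" for x
    using H1_maps[OF that] by (simp add: A_def)
  have v: "v j \<in> D" and Hv: "the (H \<tau> (v j)) = l j *\<^sub>R v j" for j
    using eigen by (auto simp: v_def l_def)
  have onb: "orthonormal_basis v"
    using basis by (simp add: v_def[abs_def])
  then have ortho: "cinner (v j) (v k) = (if j = k then 1 else 0)" for j k
    by (simp add: orthonormal_basis_def)
  have D_scaleR: "r *\<^sub>R x \<in> D" if "x \<in> D" for r x
    using sa[of \<tau>] that dom_H complex_space.subspace_scale
    by (auto simp: self_adjoint_def linear_operator_def scaleR_eq_scaleC)
  \<comment> \<open>Homogeneity of \<open>H1\<close> is inherited from that of \<open>H t\<close> by
    differentiation; it serves to evaluate \<open>H1\<close> at \<open>l j *\<^sub>R v j\<close>,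
    the value of \<open>H \<tau>\<close> at \<open>v j\<close>, in the commutators.\<close>
  have A_scaleR: "A (r *\<^sub>R v j) = r *\<^sub>R A (v j)" for r j
  proof -
    have "r *\<^sub>R v j \<in> dom (op_deriv H \<tau>)" and v': "v j \<in> dom (op_deriv H \<tau>)"
      using H1_dom H1 v D_scaleR by (metis subsetD)+
    note op_deriv_derivative[OF this(1)]
    moreover have "the (H t (r *\<^sub>R v j)) = r *\<^sub>R the (H t (v j))" for t
      using sa[of t] v[of j] dom_H[of t]
      by (simp add: self_adjoint_def linear_operator_def scaleR_eq_scaleC)
    ultimately have "((\<lambda>t. r *\<^sub>R the (H t (v j))) has_vector_derivative A (r *\<^sub>R v j)) (at \<tau>)"
      by (simp add: A_def H1)
    moreover have "((\<lambda>t. r *\<^sub>R the (H t (v j))) has_vector_derivative r *\<^sub>R A (v j)) (at \<tau>)"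
      using op_deriv_derivative[OF v'] by (auto intro!: derivative_eq_intros simp: A_def H1)
    ultimately show ?thesis by (rule vector_derivative_unique_at)
  qed
  have a_sym: "a j k = a k j" for j k
    using A_sym[OF v v, of j k] cinner_commute[of "v j" "A (v k)"]
    by (simp add: a_def)

  \<comment> \<open>Second-order perturbation series for a single eigenvalue\<close>
  define s where
    "s j = cinner (the (H2 (v j))) (v j) - complex_of_real (deriv (deriv (ev j)) \<tau>)" for j
  have s_sums: "(\<lambda>k. complex_of_real (2 * a j k / (l k - l j))) sums s j" for j
    \<comment> \<open>Terms with \<open>l k = l j\<close> vanish on the left because division by zero gives zero.\<close>
  proof -
    obtain l1 where l1: "\<And>t. (ev j has_vector_derivative l1 t) (at t)" "real_analytic l1"
      using real_analytic_has_derivative[OF ev_analytic] by blast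
    obtain l2 where l2: "(l1 has_vector_derivative l2) (at \<tau>)"
      using real_analytic_has_derivative[OF l1(2)] by metis
    have "deriv (ev j) = l1"
      using l1(1) by (auto simp: fun_eq_iff has_real_derivative_iff_has_vector_derivative intro: DERIV_imp_deriv)
    then have l2_eq: "deriv (deriv (ev j)) \<tau> = l2"
      using l2 by (auto simp: has_real_derivative_iff_has_vector_derivative intro: DERIV_imp_deriv)
    obtain u1 where u1: "\<And>t. (u j has_vector_derivative u1 t) (at t)" "real_analytic u1"
      using real_analytic_has_derivative[OF u_analytic] by blast
    obtain u2 where u2: "(u1 has_vector_derivative u2) (at \<tau>)"
      using real_analytic_has_derivative[OF u1(2)] by metis
    define g where "g k t = the (H t (v k)) - ev j t *\<^sub>R v k" for k t
    define g1 where "g1 k t = the (op_deriv H t (v k)) - l1 t *\<^sub>R v k" for k t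
    define g2 where "g2 k = the (H2 (v k)) - l2 *\<^sub>R v k" for k
    have zero: "cinner (g k t) (u j t) = 0" for k t
      using eigen[of j t] H_sym[OF v, of "u j t" t k]
      by (simp add: g_def cinner_diff_left cinner_scaleR_left cinner_scaleR_right)
    have g: "\<forall>\<^sub>F t in nhds \<tau>. (g k has_vector_derivative g1 k t) (at t)" for k
    proof -
      have "v k \<in> dom (op_deriv (op_deriv H) \<tau>)" using H2_dom H2 v by auto
      from op_deriv_dom_eventually[OF this] show ?thesis
      proof eventually_elim
        case (elim t)
        show ?case
          unfolding g_def g1_def
          using op_deriv_derivative[OF elim] l1(1)[of t]
          by (auto intro!: derivative_eq_intros simp: has_real_derivative_iff_has_vector_derivative)
      qed
    qed
    have g1: "(g1 k has_vector_derivative g2 k) (at \<tau>)" for k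
      unfolding g1_def g2_def H2
      using op_deriv_derivative[of "v k" "op_deriv H" \<tau>] H2_dom H2 v[of k] l2
      by (auto intro!: derivative_eq_intros simp: has_real_derivative_iff_has_vector_derivative)
    note derivs = cinner_zero_derivatives[OF zero g g1 u1(1) u2]
    have g\<tau>: "g k \<tau> = (l k - l j) *\<^sub>R v k" for k
      using Hv by (simp add: g_def l_def algebra_simps)
    have g1\<tau>: "g1 k \<tau> = A (v k) - l1 \<tau> *\<^sub>R v k" for k
      by (simp add: g1_def A_def H1)
    \<comment> \<open>For \<open>k = j\<close> this is the formula for the first derivative of the
      eigenvalue; for \<open>l k \<noteq> l j\<close> it determines the component of
      \<open>u1 \<tau>\<close> along \<open>v k\<close>.\<close>
    have first: "cinner (A (v k)) (v j) = of_real (l1 \<tau>) * (if k = j then 1 else 0)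
        - of_real (l k - l j) * cinner (v k) (u1 \<tau>)" for k
      using derivs(1)[of k] ortho[of k j]
      by (simp add: g\<tau> g1\<tau> cinner_diff_left cinner_scaleR_left algebra_simps flip: v_def split: if_splits)
    \<comment> \<open>With \<open>k = j\<close> the vector \<open>g j \<tau>\<close> is zero, so the
      term with \<open>u2\<close> drops out.\<close>
    have second: "s j = - 2 * cinner (g1 j \<tau>) (u1 \<tau>)"
      using derivs(2)[of j] ortho[of j j]
      by (simp add: g\<tau> s_def l2_eq g2_def cinner_diff_left cinner_scaleR_left cinner_zero_left
          algebra_simps add_eq_0_iff2 flip: v_def)
    have "(\<lambda>k. - 2 * (cinner (g1 j \<tau>) (v k) * cinner (v k) (u1 \<tau>))) sums s j"
      unfolding second by (intro sums_mult parseval onb)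
    moreover have "- 2 * (cinner (g1 j \<tau>) (v k) * cinner (v k) (u1 \<tau>))
        = complex_of_real (2 * a j k / (l k - l j))" for k
    proof (cases "l k = l j")
      \<comment> \<open>The component of \<open>u1 \<tau>\<close> along \<open>v k\<close> is
        undetermined here, but its cofactor vanishes: for \<open>k = j\<close> the value
        \<open>l1 \<tau>\<close> cancels, otherwise the matrix element is 0 by
        \<open>first\<close>.\<close>
      case True
      have "cinner (A (v j)) (v k) = cnj (cinner (A (v k)) (v j))"
        using A_sym[OF v v, of j k] cinner_commute by metis
      then have "cinner (g1 j \<tau>) (v k) = 0"
        using first[of k] True ortho[of j k]
        by (simp add: g1\<tau> cinner_diff_left cinner_scaleR_left)
      then show ?thesis using True by simp
    next
      case False
      then have "k \<noteq> j" by auto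
      then have "cinner (v k) (u1 \<tau>) = - cinner (A (v k)) (v j) / of_real (l k - l j)"
        using first[of k] False by (simp add: field_simps)
      moreover have "cinner (A (v k)) (v j) = cnj (cinner (A (v j)) (v k))"
        using A_sym[OF v v, of k j] cinner_commute by metis
      moreover have "cinner (g1 j \<tau>) (v k) = cinner (A (v j)) (v k)"
        using \<open>k \<noteq> j\<close> ortho[of j k] by (simp add: g1\<tau> cinner_diff_left cinner_scaleR_left)
      ultimately show ?thesis
        by (simp add: a_def complex_norm_square mult.assoc del: of_real_power)
    qed
    ultimately show ?thesis by simp
  qed
  \<comment> \<open>All terms are real, hence so is the sum; this reduces the bounds to real
    series.\<close>
  then have s_Re: "(\<lambda>k. 2 * a j k / (l k - l j)) sums Re (s j)" for j
    using sums_Re[OF s_sums] by simp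
  have s_real: "s j = of_real (Re (s j))" for j
    using sums_of_real[OF s_Re, where 'a=complex] s_sums by (rule sums_unique2[symmetric])

  \<comment> \<open>Commutators at the eigenvectors\<close>
  have H1_v: "H1 x = Some (A x)" if "x \<in> D" for x
    using that H1_dom by (auto simp: A_def domIff)
  have H_v: "H \<tau> x = Some (the (H \<tau> x))" if "x \<in> D" for x
    using that dom_H[of \<tau>] by (auto simp: domIff)
  have comm: "commutator (H \<tau>) H1 (v j) = Some (the (H \<tau> (A (v j))) - l j *\<^sub>R A (v j))"
    and comm': "commutator H1 (H \<tau>) (v j) = Some (l j *\<^sub>R A (v j) - the (H \<tau> (A (v j))))" for j
  proof -
    obtain w where "H \<tau> (A (v j)) = Some w" "the (H \<tau> (A (v j))) = w"
      using H_v[OF A_maps[OF v]] by metis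
    moreover have "H \<tau> (v j) = Some (l j *\<^sub>R v j)"
      using H_v[OF v] Hv by metis
    moreover have "H1 (l j *\<^sub>R v j) = Some (l j *\<^sub>R A (v j))"
      using H1_v[OF D_scaleR[OF v]] by (simp add: A_scaleR)
    ultimately show "commutator (H \<tau>) H1 (v j) = Some (the (H \<tau> (A (v j))) - l j *\<^sub>R A (v j))"
      "commutator H1 (H \<tau>) (v j) = Some (l j *\<^sub>R A (v j) - the (H \<tau> (A (v j))))"
      using H1_v[OF v, of j] by (simp_all add: commutator_def map_comp_def)
  qed

  \<comment> \<open>Series for the double commutator form\<close>
  define c where "c j = double_commutator_form H1 (H \<tau>) (v j)" for j
  have HA: "cinner (the (H \<tau> (A (v j)))) (v k) = of_real (l k) * cinner (A (v j)) (v k)" for j k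
    using H_sym[OF A_maps[OF v] v] by (simp add: Hv cinner_scaleR_right)
  have c_sums: "(\<lambda>k. complex_of_real (2 * (l k - l j) * a j k)) sums c j" for j
  proof -
    have "the ((H \<tau> \<circ>\<^sub>m (H1 \<circ>\<^sub>m H1)) (v j)) = the (H \<tau> (A (A (v j))))"
      using H1_v[OF v, of j] H1_v[OF A_maps[OF v], of j] by (simp add: map_comp_def)
    \<comment> \<open>Symmetry moves \<open>H \<tau>\<close> onto the eigenvector, giving the factor
      \<open>l j\<close>, and then one \<open>A\<close> to the right.\<close>
    moreover have "cinner (the (H \<tau> (A (A (v j))))) (v j) = of_real (l j) * cinner (A (v j)) (A (v j))"
      using H_sym[OF A_maps[OF A_maps[OF v]] v, of \<tau> j j] A_sym[OF A_maps[OF v] v, of j j]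
      by (simp add: Hv cinner_scaleR_right)
    moreover have "the ((H \<tau> \<circ>\<^sub>m H1) (v j)) = the (H \<tau> (A (v j)))"
      using H1_v[OF v, of j] by (simp add: map_comp_def)
    \<comment> \<open>The inner commutator contributes this inner product once, and the remaining
      two terms together contribute it a second time.\<close>
    ultimately have c_eq: "c j = 2 * cinner (the (H \<tau> (A (v j))) - l j *\<^sub>R A (v j)) (A (v j))"
      by (simp add: c_def double_commutator_form_def comm A_def[symmetric] cinner_diff_left
          cinner_scaleR_left algebra_simps)
    have "(\<lambda>k. 2 * (cinner (the (H \<tau> (A (v j))) - l j *\<^sub>R A (v j)) (v k) * cinner (v k) (A (v j)))) sums c j"
      unfolding c_eq by (intro sums_mult parseval onb)
    moreover have "2 * (cinner (the (H \<tau> (A (v j))) - l j *\<^sub>R A (v j)) (v k) * cinner (v k) (A (v j)))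
        = complex_of_real (2 * (l k - l j) * a j k)" for k
      by (subst cinner_commute[of "v k"])
        (simp add: cinner_diff_left cinner_scaleR_left HA a_def complex_norm_square
          algebra_simps del: of_real_power)
    ultimately show ?thesis by simp
  qed
  then have c_Re: "(\<lambda>k. 2 * (l k - l j) * a j k) sums Re (c j)" for j
    using sums_Re[OF c_sums] by simp
  have c_real: "c j = of_real (Re (c j))" for j
    using sums_of_real[OF c_Re, where 'a=complex] c_sums by (rule sums_unique2[symmetric])

  \<comment> \<open>Summation over the eigenvalues in \<open>J\<close>, and the commuting
    case\<close>
  define I where "I = {j. ev j \<tau> \<in> J}"
  \<comment> \<open>An eigenvalue with index outside \<open>I\<close> lies in \<open>Jc\<close>
    because every \<open>ev k \<tau>\<close> is in the spectrum; it is thus at least the infimum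
    over \<open>Jc\<close>, while \<open>l j\<close> is at most the supremum over
    \<open>J\<close>.\<close>
  have gap_I: "d \<le> l k - l j" if "j \<in> I" "k \<notin> I" for j k
  proof -
    have "l k \<in> Jc" "l j \<in> J"
      using that spectrum[of \<tau>] by (auto simp: Jc I_def l_def)
    then have "(INF \<mu>\<in>Jc. ereal \<mu>) \<le> ereal (l k)" "ereal (l j) \<le> (SUP \<mu>\<in>J. ereal \<mu>)"
      by (auto intro: INF_lower SUP_upper)
    then have "ereal d \<le> ereal (l k) - ereal (l j)"
      unfolding gap by (rule ereal_minus_mono)
    then show ?thesis by simp
  qed
  have S_eq: "(\<Sum>j\<in>I. cinner (the (H2 (v j))) (v j)) - (\<Sum>j\<in>I. complex_of_real (deriv (deriv (ev j)) \<tau>))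
      = of_real (\<Sum>j\<in>I. Re (s j))"
    using s_real by (simp add: s_def flip: sum_subtractf)
  have C_eq: "(\<Sum>j\<in>I. double_commutator_form H1 (H \<tau>) (v j)) = of_real (\<Sum>j\<in>I. Re (c j))"
    using c_real by (simp add: c_def)
  have "0 \<le> (\<Sum>j\<in>I. Re (s j)) \<and> (\<Sum>j\<in>I. Re (s j)) \<le> 1 / d\<^sup>2 * (\<Sum>j\<in>I. Re (c j))"
  proof (cases "finite I")
    case True
    have "a j k \<ge> 0" for j k by (simp add: a_def)
    then show ?thesis
      using spectral_cluster_bounds[OF True d_pos gap_I a_sym _ s_Re c_Re] by blast
  qed simp \<comment> \<open>Sums over infinite index sets are zero.\<close>
  then have bounds: "0 \<le> complex_of_real (\<Sum>j\<in>I. Re (s j))"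
    "complex_of_real (\<Sum>j\<in>I. Re (s j))
      \<le> complex_of_real (1 / d\<^sup>2) * (\<Sum>j\<in>I. double_commutator_form H1 (H \<tau>) (v j))"
    unfolding C_eq by (simp_all only: of_real_mult[symmetric] less_eq_complex_def) auto
  \<comment> \<open>If \<open>H1\<close> and \<open>H \<tau>\<close> commute, \<open>A (v j)\<close>
    satisfies the eigenvalue equation for \<open>l j\<close>. So \<open>a j k = 0\<close> unless
    \<open>l k = l j\<close>, and then the quotient is 0 by convention: every term of the series
    vanishes, for every \<open>j\<close>.\<close>
  have "s j = 0" if "operators_commute H1 (H \<tau>)" for j
  proof -
    have "l j *\<^sub>R A (v j) = the (H \<tau> (A (v j)))"
      using that comm'[of j] by (force simp: operators_commute_def dom_def)
    then have *: "of_real (l j) * cinner (A (v j)) (v k) = of_real (l k) * cinner (A (v j)) (v k)" for k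
      using HA[of j k] by (simp add: cinner_scaleR_left[symmetric])
    have "a j k / (l k - l j) = 0" for k
      using *[of k] by (cases "l k = l j") (auto simp: a_def)
    then have "2 * a j k / (l k - l j) = 0" for k
      by (simp only: times_divide_eq_right[symmetric] mult_zero_right)
    then have "(\<lambda>k. 0) sums s j"
      using s_sums[of j] by (simp only: of_real_0)
    then show ?thesis
      using sums_unique2[OF sums_zero] by metis
  qed
  then have commuting: "(\<Sum>j\<in>I. Re (s j)) = 0 \<and>
      (\<forall>j. complex_of_real (deriv (deriv (ev j)) \<tau>) = cinner (the (H2 (v j))) (v j))"
    if "operators_commute H1 (H \<tau>)"
    using that by (simp add: s_def)
  \<comment> \<open>Where each \<open>v j\<close> lies in the domain of the double commutator,
    symmetry of \<open>H1\<close> makes the form agree with the operator expression.\<close>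
  have double: "(\<Sum>j\<in>I. double_commutator_form H1 (H \<tau>) (v j))
      = (\<Sum>j\<in>I. cinner (the (commutator H1 (commutator (H \<tau>) H1) (v j))) (v j))"
    if "\<forall>j\<in>I. v j \<in> dom (commutator H1 (commutator (H \<tau>) H1))"
    using that by (intro sum.cong double_commutator_form_eq H1_sym) auto
  show ?thesis
    unfolding Let_def I_def[symmetric] v_def[symmetric] S_eq
  proof (intro conjI impI)
    show "0 \<le> complex_of_real (\<Sum>j\<in>I. Re (s j))" by (rule bounds)
    show "complex_of_real (\<Sum>j\<in>I. Re (s j))
        \<le> complex_of_real (1 / d\<^sup>2) * (\<Sum>j\<in>I. double_commutator_form H1 (H \<tau>) (v j))"
      by (rule bounds)
    show "complex_of_real (\<Sum>j\<in>I. Re (s j)) \<le> complex_of_real (1 / d\<^sup>2) *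
        (\<Sum>j\<in>I. cinner (the (commutator H1 (commutator (H \<tau>) H1) (v j))) (v j))"
      if "\<forall>j\<in>I. v j \<in> dom (commutator H1 (commutator (H \<tau>) H1))"
      using bounds(2) unfolding double[OF that] .
    show "complex_of_real (\<Sum>j\<in>I. Re (s j)) = 0" if "operators_commute H1 (H \<tau>)"
      using commuting[OF that] by (simp only: of_real_0)
    show "\<forall>j. complex_of_real (deriv (deriv (ev j)) \<tau>) = cinner (the (H2 (v j))) (v j)"
      if "operators_commute H1 (H \<tau>)"
      using commuting[OF that] by blast
  qed
qed

end
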